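(* For every positive integer $b$, there exists an integer $n_0=n_0(b)$ for which the following holds. Suppose that: (i) $G$ is a graph with $|V(G)|=n\geq n_0$, and (ii) $G$ is $\left(10^4\log_2 n\cdot b^2(\log_2 b)^2\right)$-edge-connected, and (iii) the chromatic number satisfies $\chi(G)\ge 3$. Then Maker has a winning strategy in the $(1:b)$ game $\mathcal{NC}_2(G)$ (the odd cycle game played on the edge set $E(G)$).
   Context: Graphs are finite and simple. For a real number $k$, "$k$-edge-connected" means that the edge-connectivity is at least $k$. Let $X$ be a finite set (the board) and let $\mathcal{F}\subseteq 2^X$ be a family of subsets of $X$ (the winning sets). In an $(a:b)$ Maker-Breaker game $(X,\mathcal{F})$, two players, Maker and Breaker, take turns claiming previously unclaimed elements of $X$. Maker claims exactly $a$ elements per turn and Breaker claims exactly $b$ elements per turn, and Maker is the first player. The game ends when every element of $X$ has been claimed by a player. Maker wins if he is able to fully claim some member of $\mathcal{F}$; otherwise Breaker wins. The odd cycle game $\mathcal{NC}_2(G)$ is the game with board $X=E(G)$ whose winning sets are the edge sets of all subgraphs $H\subseteq G$ that are not $2$-colorable; equivalently, Maker wins if and only if the edges he claims contain an odd cycle.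
   Formalization: The case b = 1 is excluded (b ≥ 2 is assumed): for b = 1, log_2 b = 0 makes the edge-connectivity condition void, and long odd cycles are then counterexamples, since Breaker can claim an edge of the only odd cycle. *)

theory Defs
  imports Complex_Main
begin

section \<open>Finite simple graphs\<close>

definition simple_graph :: "'v set \<Rightarrow> 'v set set \<Rightarrow> bool" where
  "simple_graph V E \<longleftrightarrow> finite V \<and> (\<forall>e\<in>E. e \<subseteq> V \<and> card e = 2)"

definition connected_graph :: "'v set \<Rightarrow> 'v set set \<Rightarrow> bool" where
  "connected_graph V E \<longleftrightarrow>
     V \<noteq> {} \<and> (\<forall>u\<in>V. \<forall>v\<in>V. (u, v) \<in> {(x, y). {x, y} \<in> E}\<^sup>*)"

text \<open>On at least two vertices, deleting all edges disconnects the graph, so the minimum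
  is over a nonempty finite set. Graphs with at most one vertex get edge-connectivity 0.\<close>

definition edge_connectivity :: "'v set \<Rightarrow> 'v set set \<Rightarrow> nat" where
  "edge_connectivity V E =
     (if card V \<le> 1 then 0
      else Min (card ` {F. F \<subseteq> E \<and> \<not> connected_graph V (E - F)}))"

definition edge_connected :: "real \<Rightarrow> 'v set \<Rightarrow> 'v set set \<Rightarrow> bool" where
  "edge_connected k V E \<longleftrightarrow> k \<le> real (edge_connectivity V E)"

definition colorable :: "nat \<Rightarrow> 'v set \<Rightarrow> 'v set set \<Rightarrow> bool" where
  "colorable k V E \<longleftrightarrow>
     (\<exists>f :: 'v \<Rightarrow> nat. (\<forall>v\<in>V. f v < k) \<and> (\<forall>u v. {u, v} \<in> E \<longrightarrow> f u \<noteq> f v))"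

definition chromatic_number :: "'v set \<Rightarrow> 'v set set \<Rightarrow> nat" where
  "chromatic_number V E = (LEAST k. colorable k V E)"

section \<open>Maker-Breaker games\<close>

text \<open>A play is recorded as the list of the sets claimed in successive turns. Maker moves
  first, so the entries at even positions are his. A player who finds fewer unclaimed elements
  than his bias claims all of them; no turn is taken once the board is exhausted.\<close>

definition legal_move :: "'x set \<Rightarrow> nat \<Rightarrow> nat \<Rightarrow> 'x set list \<Rightarrow> 'x set \<Rightarrow> bool" where
  "legal_move X a b h D \<longleftrightarrow>
     (let R = X - \<Union> (set h)
      in R \<noteq> {} \<and> D \<subseteq> R \<and> card D = min (if even (length h) then a else b) (card R))"

definition legal_play :: "'x set \<Rightarrow> nat \<Rightarrow> nat \<Rightarrow> 'x set list \<Rightarrow> bool" where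
  "legal_play X a b h \<longleftrightarrow> (\<forall>i<length h. legal_move X a b (take i h) (h ! i))"

definition maker_claim :: "'x set list \<Rightarrow> 'x set" where
  "maker_claim h = \<Union> {h ! i | i. i < length h \<and> even i}"

definition follows :: "('x set list \<Rightarrow> 'x set) \<Rightarrow> 'x set list \<Rightarrow> bool" where
  "follows \<sigma> h \<longleftrightarrow> (\<forall>i<length h. even i \<longrightarrow> h ! i = \<sigma> (take i h))"

text \<open>The second conjunct makes the first one meaningful: it forces the strategy to supply a
  legal move whenever it is Maker's turn, so that no play gets stuck before the board is full.\<close>

definition maker_winning_strategy ::
  "'x set \<Rightarrow> 'x set set \<Rightarrow> nat \<Rightarrow> nat \<Rightarrow> ('x set list \<Rightarrow> 'x set) \<Rightarrow> bool" where
  "maker_winning_strategy X \<F> a b \<sigma> \<longleftrightarrow>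
     (\<forall>h. legal_play X a b h \<and> follows \<sigma> h \<longrightarrow>
        (\<Union> (set h) = X \<longrightarrow> (\<exists>W\<in>\<F>. W \<subseteq> maker_claim h)) \<and>
        (\<Union> (set h) \<noteq> X \<and> even (length h) \<longrightarrow> legal_move X a b h (\<sigma> h)))"

definition maker_wins :: "'x set \<Rightarrow> 'x set set \<Rightarrow> nat \<Rightarrow> nat \<Rightarrow> bool" where
  "maker_wins X \<F> a b \<longleftrightarrow> (\<exists>\<sigma>. maker_winning_strategy X \<F> a b \<sigma>)"

section \<open>The non-colorability game\<close>

text \<open>The edge sets of all subgraphs that are not \<open>k\<close>-colorable; for \<open>k = 2\<close> these are the
  winning sets of the odd cycle game, whose board is \<open>E\<close>.\<close>

definition NC_winning_sets :: "nat \<Rightarrow> 'v set \<Rightarrow> 'v set set \<Rightarrow> 'v set set set" where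
  "NC_winning_sets k V E =
     {E'. \<exists>V'. V' \<subseteq> V \<and> E' \<subseteq> E \<and> simple_graph V' E' \<and> \<not> colorable k V' E'}"

end

theory Submission
  imports Defs
begin

text \<open>
  Let \<open>A\<^sub>0\<close> be one side of a maximum cut of \<open>G\<close>, write \<open>\<delta>(S)\<close> for the set of edges leaving \<open>S\<close>,
  and call \<open>E - \<delta>(A)\<close> the defect of \<open>A\<close>. Maker's graph contains an odd cycle exactly when it
  meets the defect of every \<open>A \<subseteq> V\<close>. The defect of \<open>A\<^sub>0\<close> (and of its complement) may be tiny, but
  it is nonempty because \<open>G\<close> is not bipartite, so Maker takes one of its edges in the first turn.

  All other defects are large. An edge leaving \<open>S = A \<triangle> A\<^sub>0\<close> leaves exactly one of \<open>A\<close>, \<open>A\<^sub>0\<close>, so it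
  lies in one of the two defects; as the defect of \<open>A\<^sub>0\<close> is the smallest, the defect of \<open>A\<close> has at
  least \<open>\<bar>\<delta>(S)\<bar> / 2\<close> elements. Karger's contraction argument (\<open>few_small_cuts\<close>) shows that a
  graph with \<open>n\<close> vertices and edge-connectivity \<open>k\<close> has at most \<open>(2n)\<^sup>a\<close> sets \<open>S\<close> with
  \<open>\<bar>\<delta>(S)\<bar> \<le> a k / 2\<close>. Hence the number of defects grows only polynomially with their size, and
  once \<open>k\<close> exceeds a constant times \<open>b log n\<close> the sum of \<open>(1 + 1/(2b))\<close> to the power
  \<open>- \<bar>E - \<delta>(A)\<bar>\<close> is below \<open>1/2\<close> (\<open>cut_sum_less_half\<close>).

  This is what Beck's biased form of the Erdos-Selfridge criterion needs
  (\<open>maker_wins_if_potential_small\<close>): from the second turn on, Maker always takes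
  the edge of largest total weight in the defects that he has not met yet, and so meets them all.
\<close>

section \<open>Counting small cuts\<close>

text \<open>Contraction creates parallel edges and loops, so edges are abstract indices with two end
  points \<open>p i\<close> and \<open>q i\<close>.\<close>

definition cut_edges :: "('e \<Rightarrow> 'c) \<Rightarrow> ('e \<Rightarrow> 'c) \<Rightarrow> 'e set \<Rightarrow> 'c set \<Rightarrow> 'e set" where
  "cut_edges p q I S = {i \<in> I. (p i \<in> S) \<noteq> (q i \<in> S)}"

lemma finite_cut_edges [simp]: "finite I \<Longrightarrow> finite (cut_edges p q I S)"
  by (simp add: cut_edges_def)

lemma sum_singleton_cuts:
  assumes "finite Q" "finite I" "p ` I \<subseteq> Q" "q ` I \<subseteq> Q"
  shows "(\<Sum>v\<in>Q. card (cut_edges p q I {v})) = 2 * card {i \<in> I. p i \<noteq> q i}"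
proof -
  have "card {v \<in> Q. (p i = v) \<noteq> (q i = v)} = (if p i \<noteq> q i then 2 else 0)" if "i \<in> I" for i
  proof -
    have "{v \<in> Q. (p i = v) \<noteq> (q i = v)} = (if p i \<noteq> q i then {p i, q i} else {})"
      using assms that by auto
    then show ?thesis by simp
  qed
  then have "(\<Sum>v\<in>Q. card {i \<in> I. (p i = v) \<noteq> (q i = v)}) = (\<Sum>i\<in>I. if p i \<noteq> q i then 2 else 0)"
    using assms by (intro sum_multicount_gen) auto
  also have "\<dots> = 2 * card {i \<in> I. p i \<noteq> q i}"
    using assms by (simp add: sum.If_cases Int_def)
  finally show ?thesis by (simp add: cut_edges_def)
qed

text \<open>Karger's argument, with counting in place of a random contraction. For \<open>n = a\<close> the bound is
  the number of all subsets. For \<open>n > a\<close>, at least \<open>n k / 2\<close> edges are not loops because every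
  vertex has degree at least \<open>k\<close>, and contracting one of them preserves exactly the sets \<open>S\<close>
  that it does not leave. A set with \<open>\<bar>\<delta>(S)\<bar> \<le> a k / 2\<close> is therefore preserved by at least a
  fraction \<open>1 - a / n\<close> of the contractions, which is the ratio of the bounds for \<open>n - 1\<close> and
  \<open>n\<close>.\<close>

lemma few_small_cuts_binomial:
  assumes "finite I" "finite Q" "card Q = n" "a \<le> n" "a > 0" "k > 0"
    and "p ` I \<subseteq> Q" "q ` I \<subseteq> Q"
    and "\<And>S. S \<subseteq> Q \<Longrightarrow> S \<noteq> {} \<Longrightarrow> S \<noteq> Q \<Longrightarrow> k \<le> card (cut_edges p q I S)"
  shows "card {S. S \<subseteq> Q \<and> 2 * card (cut_edges p q I S) \<le> a * k} \<le> 2 ^ a * (n choose a)"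
  using assms(4,2,3,7-9)
proof (induction n arbitrary: Q p q rule: dec_induct)
  case base
  have "card {S. S \<subseteq> Q \<and> 2 * card (cut_edges p q I S) \<le> a * k} \<le> card (Pow Q)"
    using base by (intro card_mono) auto
  then show ?case using base by (simp add: card_Pow)
next
  case (step m)
  define n where "n = Suc m"
  define F where "F = {S. S \<subseteq> Q \<and> 2 * card (cut_edges p q I S) \<le> a * k}"
  define J where "J = {i \<in> I. p i \<noteq> q i}"
  let ?B = "2 ^ a * (m choose a)"
  have fin: "finite F" "finite J" "finite I" "finite Q"
    unfolding F_def J_def using \<open>finite Q\<close> \<open>finite I\<close> by auto
  have n2: "n \<ge> 2" using step.hyps \<open>a > 0\<close> n_def by simp
  have "n * k \<le> (\<Sum>v\<in>Q. card (cut_edges p q I {v}))"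
  proof -
    have "k \<le> card (cut_edges p q I {v})" if "v \<in> Q" for v
      using that step.prems n2 n_def by (intro step.prems(5)) auto
    then have "(\<Sum>v\<in>Q. k) \<le> (\<Sum>v\<in>Q. card (cut_edges p q I {v}))" by (intro sum_mono)
    then show ?thesis using step.prems n_def by simp
  qed
  then have many: "n * k \<le> 2 * card J"
    using sum_singleton_cuts[of Q I p q] step.prems fin by (simp add: J_def)
  have contract: "card {S \<in> F. (p i \<in> S) = (q i \<in> S)} \<le> ?B" if i: "i \<in> J" for i
  proof -
    define \<tau> where "\<tau> = (\<lambda>v. if v = q i then p i else v)"
    let ?Q = "Q - {q i}" and ?p = "\<tau> \<circ> p" and ?q = "\<tau> \<circ> q"
    have iI: "i \<in> I" "p i \<noteq> q i" "p i \<in> Q" "q i \<in> Q" using i step.prems by (auto simp: J_def)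
    have bound: "card {S. S \<subseteq> ?Q \<and> 2 * card (cut_edges ?p ?q I S) \<le> a * k} \<le> ?B"
    proof (rule step.IH)
      show "finite ?Q" "card ?Q = m" using step.prems iI by auto
      show "?p ` I \<subseteq> ?Q" "?q ` I \<subseteq> ?Q" using step.prems iI by (auto simp: \<tau>_def)
      fix S assume S: "S \<subseteq> ?Q" "S \<noteq> {}" "S \<noteq> ?Q"
      let ?S = "{v \<in> Q. \<tau> v \<in> S}"
      have "cut_edges ?p ?q I S = cut_edges p q I ?S"
        using step.prems by (auto simp: cut_edges_def)
      moreover have "?S \<noteq> {}" using S by (auto simp: \<tau>_def)
      moreover have "?S \<noteq> Q"
      proof -
        obtain v where "v \<in> ?Q" "v \<notin> S" using S by auto
        then have "v \<in> Q" "v \<notin> ?S" by (auto simp: \<tau>_def)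
        then show ?thesis by auto
      qed
      ultimately show "k \<le> card (cut_edges ?p ?q I S)"
        using step.prems(5)[of ?S] by auto
    qed
    have cut: "cut_edges ?p ?q I (S - {q i}) = cut_edges p q I S"
      if "(p i \<in> S) = (q i \<in> S)" for S
      using that iI by (auto simp: cut_edges_def \<tau>_def)
    have "card {S \<in> F. (p i \<in> S) = (q i \<in> S)}
        \<le> card {S. S \<subseteq> ?Q \<and> 2 * card (cut_edges ?p ?q I S) \<le> a * k}"
    proof (rule card_inj_on_le[where f = "\<lambda>S. S - {q i}"])
      show "inj_on (\<lambda>S. S - {q i}) {S \<in> F. (p i \<in> S) = (q i \<in> S)}"
      proof (rule inj_onI)
        fix S T
        assume S: "S \<in> {S \<in> F. (p i \<in> S) = (q i \<in> S)}" and T: "T \<in> {S \<in> F. (p i \<in> S) = (q i \<in> S)}"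
          and eq: "S - {q i} = T - {q i}"
        have "p i \<in> S \<longleftrightarrow> p i \<in> T" using eq iI by blast
        then have "q i \<in> S \<longleftrightarrow> q i \<in> T" using S T by simp
        then show "S = T" using eq by blast
      qed
      show "(\<lambda>S. S - {q i}) ` {S \<in> F. (p i \<in> S) = (q i \<in> S)}
          \<subseteq> {S. S \<subseteq> ?Q \<and> 2 * card (cut_edges ?p ?q I S) \<le> a * k}"
      proof (rule image_subsetI)
        fix S assume "S \<in> {S \<in> F. (p i \<in> S) = (q i \<in> S)}"
        then have "S \<subseteq> Q" "2 * card (cut_edges p q I S) \<le> a * k" "(p i \<in> S) = (q i \<in> S)"
          unfolding F_def by blast+
        then show "S - {q i} \<in> {S. S \<subseteq> ?Q \<and> 2 * card (cut_edges ?p ?q I S) \<le> a * k}"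
          by (simp only: cut mem_Collect_eq) blast
      qed
      show "finite {S. S \<subseteq> ?Q \<and> 2 * card (cut_edges ?p ?q I S) \<le> a * k}"
        using \<open>finite Q\<close> by auto
    qed
    then show ?thesis using bound by linarith
  qed
  have avoid: "2 * card J \<le> 2 * card {i \<in> J. (p i \<in> S) = (q i \<in> S)} + a * k" if "S \<in> F" for S
  proof -
    have "J = {i \<in> J. (p i \<in> S) = (q i \<in> S)} \<union> cut_edges p q I S"
      by (auto simp: J_def cut_edges_def)
    then have "card J \<le> card {i \<in> J. (p i \<in> S) = (q i \<in> S)} + card (cut_edges p q I S)"
      by (metis card_Un_le)
    then show ?thesis using that by (simp add: F_def)
  qed
  have "(\<Sum>S\<in>F. card {i \<in> J. (p i \<in> S) = (q i \<in> S)}) = (\<Sum>i\<in>J. card {S \<in> F. (p i \<in> S) = (q i \<in> S)})"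
    using fin by (intro sum_multicount_gen) auto
  also have "\<dots> \<le> card J * ?B"
    using sum_mono[of J, OF contract] by simp
  finally have double: "(\<Sum>S\<in>F. card {i \<in> J. (p i \<in> S) = (q i \<in> S)}) \<le> card J * ?B" .
  have "card F * (2 * card J) \<le> (\<Sum>S\<in>F. 2 * card {i \<in> J. (p i \<in> S) = (q i \<in> S)} + a * k)"
    using sum_mono[of F, OF avoid] by simp
  also have "\<dots> = 2 * (\<Sum>S\<in>F. card {i \<in> J. (p i \<in> S) = (q i \<in> S)}) + card F * (a * k)"
    by (simp add: sum.distrib sum_distrib_left)
  also have "\<dots> \<le> 2 * card J * ?B + card F * (a * k)" using double by simp
  finally have "n * (card F * (2 * card J)) \<le> n * (2 * card J * ?B + card F * (a * k))"
    by (rule mult_le_mono2)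
  also have "\<dots> = n * (2 * card J * ?B) + card F * a * (n * k)" by (simp add: algebra_simps)
  also have "\<dots> \<le> n * (2 * card J * ?B) + card F * a * (2 * card J)"
    using many by (intro add_left_mono mult_le_mono2)
  finally have "(2 * card J) * (n * card F) \<le> (2 * card J) * (n * ?B + a * card F)"
    by (simp add: algebra_simps)
  moreover have "2 * card J > 0"
  proof -
    have "n * k > 0" using n2 \<open>k > 0\<close> by simp
    then show ?thesis using many by linarith
  qed
  ultimately have "n * card F \<le> n * ?B + a * card F" by (simp only: mult_le_cancel1)
  then have "(n - a) * card F \<le> n * ?B" by (simp add: diff_mult_distrib)
  also have "\<dots> = 2 ^ a * (n * ((n - 1) choose a))" by (simp add: n_def algebra_simps)
  also have "\<dots> = (n - a) * (2 ^ a * (n choose a))"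
    by (simp only: binomial_absorb_comp[symmetric] ac_simps)
  finally have "card F \<le> 2 ^ a * (n choose a)"
    using step.hyps n_def by simp
  then show ?case by (simp add: F_def n_def)
qed

lemma few_small_cuts:
  assumes "finite I" "finite Q" "Q \<noteq> {}" "a > 0" "k > 0" "p ` I \<subseteq> Q" "q ` I \<subseteq> Q"
    and "\<And>S. S \<subseteq> Q \<Longrightarrow> S \<noteq> {} \<Longrightarrow> S \<noteq> Q \<Longrightarrow> k \<le> card (cut_edges p q I S)"
  shows "card {S. S \<subseteq> Q \<and> 2 * card (cut_edges p q I S) \<le> a * k} \<le> (2 * card Q) ^ a"
proof (cases "a \<le> card Q")
  case True
  have "card {S. S \<subseteq> Q \<and> 2 * card (cut_edges p q I S) \<le> a * k} \<le> 2 ^ a * (card Q choose a)"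
    using assms True by (intro few_small_cuts_binomial) auto
  also have "\<dots> \<le> 2 ^ a * card Q ^ a" using True by (intro mult_le_mono2 binomial_le_pow)
  finally show ?thesis by (simp add: power_mult_distrib)
next
  case False
  have "card {S. S \<subseteq> Q \<and> 2 * card (cut_edges p q I S) \<le> a * k} \<le> card (Pow Q)"
    using assms by (intro card_mono) auto
  also have "\<dots> = 2 ^ card Q" using assms by (simp add: card_Pow)
  also have "\<dots> \<le> 2 ^ a" using False by (intro power_increasing) auto
  also have "\<dots> \<le> (2 * card Q) ^ a"
    using assms by (intro power_mono) (auto simp: Suc_le_eq card_gt_0_iff)
  finally show ?thesis .
qed

lemma geometric_sum_half:
  assumes "N \<ge> (2::nat)"
  shows "(\<Sum>a\<in>{2..<N}. (1/2::real) ^ a) < 1/2"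
proof -
  have "(\<Sum>a\<in>{2..<N}. (1/2::real) ^ a) = 1/2 - 2 * (1/2) ^ N"
    using assms by (induction N rule: dec_induct) (auto simp: power2_eq_square)
  then show ?thesis by simp
qed

text \<open>The sets are grouped by the level \<open>a = \<lfloor>2 \<bar>\<delta>(S)\<bar> / k\<rfloor>\<close>, which is at least 2. Level
  \<open>a\<close> has at most \<open>(2n)\<^bsup>a+1\<^esup>\<close> members, so with the exponent \<open>3a\<close> it contributes at most
  \<open>(2n)\<^bsup>1-2a\<^esup> \<le> 2\<^bsup>-a\<^esup>\<close>.\<close>

lemma cut_sum_less_half:
  assumes "finite I" "finite Q" "card Q \<ge> 2" "k > 0" "p ` I \<subseteq> Q" "q ` I \<subseteq> Q"
    and mincut: "\<And>S. S \<subseteq> Q \<Longrightarrow> S \<noteq> {} \<Longrightarrow> S \<noteq> Q \<Longrightarrow> k \<le> card (cut_edges p q I S)"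
  shows "(\<Sum>S\<in>Pow Q - {{}, Q}. (1 / real (2 * card Q)) ^ (3 * (2 * card (cut_edges p q I S) div k)))
         < 1/2"
proof -
  define N where "N = real (2 * card Q)"
  define lev where "lev S = 2 * card (cut_edges p q I S) div k" for S
  define T where "T = Pow Q - {{}, Q}"
  have N4: "N \<ge> 4" using assms(3) unfolding N_def by simp
  have finT: "finite T" using assms by (simp add: T_def)
  have lev2: "lev S \<ge> 2" if "S \<in> T" for S
    using mincut[of S] that \<open>k > 0\<close> unfolding lev_def T_def
    by (auto simp: less_eq_div_iff_mult_less_eq)
  have part: "(\<Sum>S\<in>{S \<in> T. lev S = a}. (1 / N) ^ (3 * lev S)) \<le> (1/2) ^ a" if "a \<ge> 2" for a
  proof -
    have "card {S \<in> T. lev S = a} \<le> card {S. S \<subseteq> Q \<and> 2 * card (cut_edges p q I S) \<le> Suc a * k}"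
    proof (rule card_mono)
      show "finite {S. S \<subseteq> Q \<and> 2 * card (cut_edges p q I S) \<le> Suc a * k}" using assms by auto
      have "2 * card (cut_edges p q I S) \<le> Suc (lev S) * k" for S
        using dividend_less_div_times[OF \<open>k > 0\<close>, of "2 * card (cut_edges p q I S)"]
        by (simp add: lev_def)
      then show "{S \<in> T. lev S = a} \<subseteq> {S. S \<subseteq> Q \<and> 2 * card (cut_edges p q I S) \<le> Suc a * k}"
        by (auto simp: T_def)
    qed
    also have "\<dots> \<le> (2 * card Q) ^ Suc a"
      using assms by (intro few_small_cuts) auto
    finally have "real (card {S \<in> T. lev S = a}) \<le> N ^ Suc a"
      unfolding N_def by (metis of_nat_le_iff of_nat_power)
    then have "real (card {S \<in> T. lev S = a}) * (1 / N) ^ (3 * a) \<le> N ^ Suc a * (1 / N) ^ (3 * a)"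
      using N4 by (intro mult_right_mono) auto
    also have "\<dots> \<le> N ^ (2 * a) * (1 / N) ^ (3 * a)"
      using N4 that by (intro mult_right_mono power_increasing) auto
    also have "\<dots> = (1 / N) ^ a"
    proof -
      have "N ^ (3 * a) = N ^ (2 * a) * N ^ a" by (simp flip: power_add)
      then show ?thesis using N4 by (simp add: power_one_over)
    qed
    also have "\<dots> \<le> (1/2) ^ a" using N4 by (intro power_mono) (auto simp: field_simps)
    finally show ?thesis by simp
  qed
  define M where "M = Suc (Suc (Suc (Max (insert 0 (lev ` T)))))"
  have "lev ` T \<subseteq> {2..<M}"
  proof
    fix a assume a: "a \<in> lev ` T"
    then have "a \<le> Max (insert 0 (lev ` T))" using finT by (intro Max_ge) auto
    then show "a \<in> {2..<M}" using a lev2 by (auto simp: M_def)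
  qed
  have "(\<Sum>S\<in>T. (1 / N) ^ (3 * lev S)) = (\<Sum>a\<in>lev ` T. \<Sum>S\<in>{S \<in> T. lev S = a}. (1 / N) ^ (3 * lev S))"
    using finT by (rule sum.image_gen)
  also have "\<dots> \<le> (\<Sum>a\<in>lev ` T. (1/2) ^ a)" using lev2 part by (intro sum_mono) auto
  also have "\<dots> \<le> (\<Sum>a\<in>{2..<M}. (1/2) ^ a)"
    using \<open>lev ` T \<subseteq> {2..<M}\<close> by (intro sum_mono2) auto
  also have "\<dots> < 1/2" by (rule geometric_sum_half) (simp add: M_def)
  finally show ?thesis by (simp add: N_def lev_def T_def)
qed

section \<open>A potential criterion for Maker\<close>

text \<open>Maker wants to meet every member of \<open>\<H>\<close>; \<open>M\<close> is the set he has claimed and \<open>C\<close> the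
  set claimed by both players. A member not yet met weighs \<open>\<mu>\<close> to the number
  of its unclaimed elements, so a member that Breaker has claimed completely has weight 1.\<close>

definition potential :: "'x set set \<Rightarrow> real \<Rightarrow> 'x set \<Rightarrow> 'x set \<Rightarrow> real" where
  "potential \<H> \<mu> M C = (\<Sum>D | D \<in> \<H> \<and> D \<inter> M = {}. \<mu> ^ card (D - C))"

definition danger :: "'x set set \<Rightarrow> real \<Rightarrow> 'x set \<Rightarrow> 'x set \<Rightarrow> 'x \<Rightarrow> real" where
  "danger \<H> \<mu> M C y = (\<Sum>D | D \<in> \<H> \<and> D \<inter> M = {} \<and> y \<in> D. \<mu> ^ card (D - C))"

lemma potential_maker_move:
  assumes "finite \<H>"
  shows "potential \<H> \<mu> (insert z M) (insert z C) = potential \<H> \<mu> M C - danger \<H> \<mu> M C z"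
proof -
  let ?hit = "{D. D \<in> \<H> \<and> D \<inter> M = {} \<and> z \<in> D}"
  let ?rest = "{D. D \<in> \<H> \<and> D \<inter> M = {} \<and> z \<notin> D}"
  have "{D. D \<in> \<H> \<and> D \<inter> M = {}} = ?hit \<union> ?rest" by auto
  then have "potential \<H> \<mu> M C = danger \<H> \<mu> M C z + (\<Sum>D\<in>?rest. \<mu> ^ card (D - C))"
    unfolding potential_def danger_def using assms by (simp add: sum.union_disjoint disjoint_iff)
  moreover have "potential \<H> \<mu> (insert z M) (insert z C) = (\<Sum>D\<in>?rest. \<mu> ^ card (D - C))"
    unfolding potential_def by (intro sum.cong) auto
  ultimately show ?thesis by simp
qed

lemma danger_maker_move:
  assumes "finite \<H>" "\<mu> \<ge> 0"
  shows "danger \<H> \<mu> (insert z M) (insert z C) y \<le> danger \<H> \<mu> M C y"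
proof -
  have "danger \<H> \<mu> (insert z M) (insert z C) y
      = (\<Sum>D | D \<in> \<H> \<and> D \<inter> insert z M = {} \<and> y \<in> D. \<mu> ^ card (D - C))"
    unfolding danger_def by (intro sum.cong) auto
  also have "\<dots> \<le> danger \<H> \<mu> M C y"
    unfolding danger_def using assms by (intro sum_mono2) auto
  finally show ?thesis .
qed

lemma danger_nonneg: "\<mu> \<ge> 0 \<Longrightarrow> danger \<H> \<mu> M C y \<ge> 0"
  unfolding danger_def by (intro sum_nonneg) auto

lemma danger_le_potential:
  "finite \<H> \<Longrightarrow> \<mu> \<ge> 0 \<Longrightarrow> danger \<H> \<mu> M C y \<le> potential \<H> \<mu> M C"
  unfolding danger_def potential_def by (intro sum_mono2) auto

text \<open>The weight base \<open>1 + 1/(2b)\<close> is small enough that \<open>b\<close> factors at most double, with the growth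
  below the chord; and large enough that \<open>2b\<close> factors at least double, which makes large sets
  light.\<close>

lemma power_le_chord:
  assumes "j \<le> b"
  shows "(1 + 1 / (2 * real b)) ^ j \<le> 1 + real j / real b"
  using assms
proof (induction j)
  case (Suc j)
  then have b: "real b > 0" and j: "real j \<le> real b" by auto
  have "(1 + 1 / (2 * real b)) ^ Suc j \<le> (1 + 1 / (2 * real b)) * (1 + real j / real b)"
    using Suc b by (auto intro: mult_left_mono)
  also have "\<dots> = 1 + real j / real b + 1 / (2 * real b) + (real j / real b) / (2 * real b)"
    using b by (simp add: field_simps)
  also have "\<dots> \<le> 1 + real j / real b + 1 / (2 * real b) + 1 / (2 * real b)"
    using b j by (intro add_left_mono divide_right_mono) auto
  also have "\<dots> = 1 + real (Suc j) / real b" using b by (simp add: field_simps)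
  finally show ?case .
qed simp

text \<open>A member that loses \<open>j \<le> b\<close> free elements gains a factor of at most \<open>1 + j / b\<close>, which is linear
  in \<open>j\<close>; so the effect of the whole turn is bounded by the sum of the dangers of its elements.\<close>

lemma potential_breaker_move:
  assumes "finite \<H>" "\<And>D. D \<in> \<H> \<Longrightarrow> finite D" "finite Y" "card Y \<le> b" "Y \<inter> C = {}"
    and \<mu>: "\<mu> = 1 / (1 + 1 / (2 * real b))"
  shows "potential \<H> \<mu> M (C \<union> Y) \<le> potential \<H> \<mu> M C + (\<Sum>y\<in>Y. danger \<H> \<mu> M C y) / real b"
proof -
  let ?A = "{D. D \<in> \<H> \<and> D \<inter> M = {}}"
  have \<mu>0: "\<mu> > 0" unfolding \<mu> by (simp add: add_pos_nonneg)
  have fA: "finite ?A" using assms by simp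
  have step: "\<mu> ^ card (D - (C \<union> Y)) \<le> \<mu> ^ card (D - C) + \<mu> ^ card (D - C) * card (D \<inter> Y) / real b"
    if D: "D \<in> ?A" for D
  proof -
    have fD: "finite D" using D assms by auto
    have "D - C = (D - (C \<union> Y)) \<union> (D \<inter> Y)" using assms by auto
    moreover have "card ((D - (C \<union> Y)) \<union> (D \<inter> Y)) = card (D - (C \<union> Y)) + card (D \<inter> Y)"
      by (rule card_Un_disjoint) (use fD in auto)
    ultimately have split: "card (D - C) = card (D - (C \<union> Y)) + card (D \<inter> Y)" by simp
    have "card (D \<inter> Y) \<le> b" using card_mono[of Y "D \<inter> Y"] assms by simp
    then have "(1 / \<mu>) ^ card (D \<inter> Y) \<le> 1 + card (D \<inter> Y) / real b"
      unfolding \<mu> using power_le_chord by simp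
    then have "\<mu> ^ card (D - C) * (1 / \<mu>) ^ card (D \<inter> Y)
        \<le> \<mu> ^ card (D - C) * (1 + card (D \<inter> Y) / real b)"
      using \<mu>0 by (intro mult_left_mono) auto
    moreover have "\<mu> ^ card (D - C) * (1 / \<mu>) ^ card (D \<inter> Y) = \<mu> ^ card (D - (C \<union> Y))"
      using \<mu>0 by (simp add: split power_add power_one_over)
    ultimately show ?thesis by (simp add: algebra_simps)
  qed
  have "(\<Sum>D\<in>?A. \<mu> ^ card (D - C) * card (D \<inter> Y)) = (\<Sum>D\<in>?A. \<Sum>y\<in>Y. if y \<in> D then \<mu> ^ card (D - C) else 0)"
    using assms(3) by (intro sum.cong) (auto simp: sum.If_cases Int_commute)
  also have "\<dots> = (\<Sum>y\<in>Y. \<Sum>D\<in>?A. if y \<in> D then \<mu> ^ card (D - C) else 0)" by (rule sum.swap)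
  also have "\<dots> = (\<Sum>y\<in>Y. danger \<H> \<mu> M C y)"
  proof (rule sum.cong[OF refl])
    fix y
    have "(\<Sum>D\<in>?A. if y \<in> D then \<mu> ^ card (D - C) else 0)
        = (\<Sum>D | D \<in> ?A \<and> y \<in> D. \<mu> ^ card (D - C))"
      by (rule sum.inter_filter[OF fA, symmetric])
    also have "{D. D \<in> ?A \<and> y \<in> D} = {D. D \<in> \<H> \<and> D \<inter> M = {} \<and> y \<in> D}" by auto
    finally show "(\<Sum>D\<in>?A. if y \<in> D then \<mu> ^ card (D - C) else 0) = danger \<H> \<mu> M C y"
      by (simp only: danger_def)
  qed
  finally have swap: "(\<Sum>D\<in>?A. \<mu> ^ card (D - C) * card (D \<inter> Y)) = (\<Sum>y\<in>Y. danger \<H> \<mu> M C y)" .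
  have "potential \<H> \<mu> M (C \<union> Y)
      \<le> (\<Sum>D\<in>?A. \<mu> ^ card (D - C) + \<mu> ^ card (D - C) * card (D \<inter> Y) / real b)"
    unfolding potential_def using step by (intro sum_mono) auto
  also have "\<dots> = potential \<H> \<mu> M C + (\<Sum>D\<in>?A. \<mu> ^ card (D - C) * card (D \<inter> Y)) / real b"
    unfolding potential_def by (simp add: sum.distrib sum_divide_distrib)
  finally show ?thesis by (simp add: swap)
qed

lemma potential_round:
  assumes "finite \<H>" "\<And>D. D \<in> \<H> \<Longrightarrow> finite D" "finite Y" "card Y \<le> b" "Y \<inter> insert z C = {}" "b > 0"
    and \<mu>: "\<mu> = 1 / (1 + 1 / (2 * real b))"
    and max: "\<And>y. y \<in> Y \<Longrightarrow> danger \<H> \<mu> M C y \<le> danger \<H> \<mu> M C z"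
  shows "potential \<H> \<mu> (insert z M) (insert z C \<union> Y) \<le> potential \<H> \<mu> M C"
proof -
  have \<mu>0: "\<mu> \<ge> 0" unfolding \<mu> by simp
  have "potential \<H> \<mu> (insert z M) (insert z C \<union> Y) \<le> potential \<H> \<mu> (insert z M) (insert z C)
      + (\<Sum>y\<in>Y. danger \<H> \<mu> (insert z M) (insert z C) y) / real b"
    using assms by (intro potential_breaker_move) auto
  also have "(\<Sum>y\<in>Y. danger \<H> \<mu> (insert z M) (insert z C) y) \<le> (\<Sum>y\<in>Y. danger \<H> \<mu> M C z)"
    using danger_maker_move[OF assms(1) \<mu>0] max by (intro sum_mono) (meson order_trans)
  also have "(\<Sum>y\<in>Y. danger \<H> \<mu> M C z) / real b \<le> danger \<H> \<mu> M C z"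
  proof -
    have "real (card Y) * danger \<H> \<mu> M C z \<le> real b * danger \<H> \<mu> M C z"
      using assms(4) danger_nonneg[OF \<mu>0] by (intro mult_right_mono) auto
    then show ?thesis using \<open>b > 0\<close> by (simp add: field_simps)
  qed
  finally show ?thesis
    using potential_maker_move[OF assms(1)] by (simp add: divide_right_mono)
qed

lemma legal_play_snoc: "legal_play X a b (h @ [D]) \<longleftrightarrow> legal_play X a b h \<and> legal_move X a b h D"
  by (auto simp: legal_play_def nth_append less_Suc_eq)

lemma follows_snoc: "follows \<sigma> (h @ [D]) \<longleftrightarrow> follows \<sigma> h \<and> (even (length h) \<longrightarrow> D = \<sigma> h)"
  by (auto simp: follows_def nth_append less_Suc_eq)

lemma maker_claim_snoc:
  "maker_claim (h @ [D]) = maker_claim h \<union> (if even (length h) then D else {})"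
proof -
  have *: "maker_claim g = (\<Union>i\<in>{i. i < length g \<and> even i}. g ! i)" for g :: "'a set list"
    by (auto simp: maker_claim_def)
  have "{i. i < length (h @ [D]) \<and> even i}
      = {i. i < length h \<and> even i} \<union> (if even (length h) then {length h} else {})"
    by (auto simp: less_Suc_eq)
  then show ?thesis unfolding * by (auto simp: nth_append)
qed

lemma maker_claim_subset: "maker_claim h \<subseteq> \<Union> (set h)"
  unfolding maker_claim_def by (auto intro: nth_mem)

text \<open>Beck's criterion, with one free move for Maker: the element \<open>e\<^sub>0\<close> is his whether or not it
  lowers the potential. Breaker's reply at most doubles the potential, which explains the
  bound \<open>1/2\<close>; afterwards no round, consisting of a move by Maker and the reply, increases it.
  At the end of the game a member of \<open>\<H>\<close> not met by Maker would have weight 1.\<close>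

theorem maker_wins_if_potential_small:
  assumes "finite X" "e\<^sub>0 \<in> X" "b > 0" "\<H> \<subseteq> Pow X"
    and small: "(\<Sum>D\<in>\<H>. (1 / (1 + 1 / (2 * real b))) ^ card D) < 1/2"
    and win: "\<And>M. M \<subseteq> X \<Longrightarrow> e\<^sub>0 \<in> M \<Longrightarrow> (\<And>D. D \<in> \<H> \<Longrightarrow> D \<inter> M \<noteq> {}) \<Longrightarrow> \<exists>W\<in>\<F>. W \<subseteq> M"
  shows "maker_wins X \<F> 1 b"
proof -
  define \<mu> where "\<mu> = 1 / (1 + 1 / (2 * real b))"
  have \<mu>0: "\<mu> \<ge> 0" by (simp add: \<mu>_def)
  have finH: "finite \<H>" using \<open>finite X\<close> \<open>\<H> \<subseteq> Pow X\<close> by (simp add: finite_subset)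
  have finD: "finite D" if "D \<in> \<H>" for D
    using that \<open>finite X\<close> \<open>\<H> \<subseteq> Pow X\<close> by (auto intro: finite_subset)
  define best where "best h z \<longleftrightarrow> z \<in> X - \<Union> (set h) \<and>
    (\<forall>y\<in>X - \<Union> (set h). danger \<H> \<mu> (maker_claim h) (\<Union> (set h)) y
       \<le> danger \<H> \<mu> (maker_claim h) (\<Union> (set h)) z)" for h z
  define \<sigma> where "\<sigma> h = (if h = [] then {e\<^sub>0} else {SOME z. best h z})" for h
  have best: "best h (SOME z. best h z)" if "X - \<Union> (set h) \<noteq> {}" for h
  proof -
    let ?d = "danger \<H> \<mu> (maker_claim h) (\<Union> (set h))"
    have fin: "finite (?d ` (X - \<Union> (set h)))" "?d ` (X - \<Union> (set h)) \<noteq> {}"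
      using \<open>finite X\<close> that by auto
    obtain z where z: "z \<in> X - \<Union> (set h)" "?d z = Max (?d ` (X - \<Union> (set h)))"
      using Max_in[OF fin] by auto
    have "?d y \<le> ?d z" if "y \<in> X - \<Union> (set h)" for y
      unfolding z(2) using fin that by (intro Max_ge) auto
    then have "best h z" unfolding best_def using z(1) by simp
    then show ?thesis by (rule someI)
  qed
  \<comment> \<open>Only whole rounds are compared. So on Breaker's turn the invariant speaks of the position
    after each of his possible replies, the empty one included in case the board is full.\<close>
  have inv: "e\<^sub>0 \<in> maker_claim h \<and> \<Union> (set h) \<subseteq> X \<and>
      (if even (length h) then potential \<H> \<mu> (maker_claim h) (\<Union> (set h)) < 1
       else \<forall>Y. Y \<subseteq> X - \<Union> (set h) \<and> card Y \<le> b
              \<longrightarrow> potential \<H> \<mu> (maker_claim h) (\<Union> (set h) \<union> Y) < 1)"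
    if "legal_play X 1 b h" "follows \<sigma> h" "h \<noteq> []" for h
    using that
  proof (induction h rule: rev_induct)
    case (snoc D h)
    have leg: "legal_play X 1 b h" "legal_move X 1 b h D" and fol: "follows \<sigma> h"
      using snoc.prems by (auto simp: legal_play_snoc follows_snoc)
    have D: "D \<subseteq> X - \<Union> (set h)" "X - \<Union> (set h) \<noteq> {}"
      using leg(2) by (auto simp: legal_move_def Let_def)
    show ?case
    proof (cases "even (length h)")
      case False
      then have "h \<noteq> []" by auto
      note IH = snoc.IH[OF leg(1) fol this]
      have "card D \<le> b" using leg(2) False by (simp add: legal_move_def Let_def)
      then have "potential \<H> \<mu> (maker_claim h) (\<Union> (set h) \<union> D) < 1" using IH D(1) False by simp
      moreover have "D \<subseteq> X" using D(1) by blast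
      ultimately show ?thesis using IH False by (simp add: maker_claim_snoc Un_commute)
    next
      case True
      have D\<sigma>: "D = \<sigma> h" using snoc.prems True by (simp add: follows_snoc)
      have pot: "potential \<H> \<mu> (maker_claim (h @ [D])) (\<Union> (set (h @ [D])) \<union> Y) < 1"
        if Y: "Y \<subseteq> X - \<Union> (set (h @ [D]))" "card Y \<le> b" for Y
      proof -
        have fY: "finite Y" using Y(1) \<open>finite X\<close> by (meson finite_Diff finite_subset)
        show ?thesis
        proof (cases "h = []")
          case h: True
          let ?P = "potential \<H> \<mu> {} {}"
          have De: "D = {e\<^sub>0}" using D\<sigma> h by (simp add: \<sigma>_def)
          have Yb: "real (card Y) * ?P \<le> real b * ?P"
            using Y by (intro mult_right_mono) (auto simp: potential_def \<mu>0 intro!: sum_nonneg)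
          have "potential \<H> \<mu> {e\<^sub>0} (insert e\<^sub>0 {} \<union> Y)
            \<le> potential \<H> \<mu> {e\<^sub>0} (insert e\<^sub>0 {})
              + (\<Sum>y\<in>Y. danger \<H> \<mu> {e\<^sub>0} (insert e\<^sub>0 {}) y) / real b"
            using Y De by (intro potential_breaker_move finH finD fY) (auto simp: \<mu>_def)
          also have "potential \<H> \<mu> {e\<^sub>0} (insert e\<^sub>0 {}) \<le> ?P"
            using potential_maker_move[OF finH, of \<mu> e\<^sub>0 "{}" "{}"] danger_nonneg[OF \<mu>0, of \<H> "{}" "{}" e\<^sub>0]
            by simp
          also have "(\<Sum>y\<in>Y. danger \<H> \<mu> {e\<^sub>0} (insert e\<^sub>0 {}) y) \<le> (\<Sum>y\<in>Y. ?P)"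
            by (intro sum_mono order_trans[OF danger_maker_move[OF finH \<mu>0]] danger_le_potential finH \<mu>0)
          also have "(\<Sum>y\<in>Y. ?P) / real b \<le> ?P" using Yb \<open>b > 0\<close> by (simp add: field_simps)
          finally have "potential \<H> \<mu> {e\<^sub>0} (insert e\<^sub>0 {} \<union> Y) \<le> 2 * ?P"
            by (simp add: divide_right_mono)
          also have "?P < 1/2" using small by (simp add: potential_def \<mu>_def)
          finally show ?thesis using h De by (simp add: maker_claim_def)
        next
          case h: False
          obtain z where Dz: "D = {z}" and bz: "best h z"
            using that[of "SOME z. best h z"] D\<sigma> h best[OF D(2)] unfolding \<sigma>_def by simp
          have "potential \<H> \<mu> (insert z (maker_claim h)) (insert z (\<Union> (set h)) \<union> Y)
            \<le> potential \<H> \<mu> (maker_claim h) (\<Union> (set h))"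
          proof (rule potential_round[OF finH finD fY Y(2) _ \<open>b > 0\<close> \<mu>_def])
            show "Y \<inter> insert z (\<Union> (set h)) = {}" using Y(1) unfolding Dz by auto
            fix y assume "y \<in> Y"
            then have "y \<in> X - \<Union> (set h)" using Y(1) by auto
            then show "danger \<H> \<mu> (maker_claim h) (\<Union> (set h)) y
                \<le> danger \<H> \<mu> (maker_claim h) (\<Union> (set h)) z"
              using bz unfolding best_def by (elim conjE) (rule bspec)
          qed
          also have "\<dots> < 1" using snoc.IH[OF leg(1) fol h] True by simp
          finally show ?thesis using True Dz by (simp add: maker_claim_snoc Un_commute)
        qed
      qed
      have "e\<^sub>0 \<in> maker_claim (h @ [D])"
      proof (cases "h = []")
        case True
        then show ?thesis using D\<sigma> by (simp add: \<sigma>_def maker_claim_def)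
      next
        case False
        then show ?thesis using snoc.IH[OF leg(1) fol] by (simp add: maker_claim_snoc)
      qed
      moreover have "\<Union> (set (h @ [D])) \<subseteq> X"
        using snoc.IH[OF leg(1) fol] D by (cases "h = []") auto
      ultimately show ?thesis using pot True by simp
    qed
  qed simp
  have "maker_winning_strategy X \<F> 1 b \<sigma>"
    unfolding maker_winning_strategy_def
  proof (intro allI impI conjI; elim conjE)
    fix h assume h: "legal_play X 1 b h" "follows \<sigma> h" and full: "\<Union> (set h) = X"
    have "h \<noteq> []" using full \<open>e\<^sub>0 \<in> X\<close> by auto
    note I = inv[OF h this]
    have less1: "potential \<H> \<mu> (maker_claim h) X < 1"
      using I full by (cases "even (length h)") (auto dest: spec[of _ "{}"])
    show "\<exists>W\<in>\<F>. W \<subseteq> maker_claim h"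
    proof (rule win)
      show "maker_claim h \<subseteq> X" using maker_claim_subset full by metis
      show "e\<^sub>0 \<in> maker_claim h" using I by simp
      fix D assume D: "D \<in> \<H>"
      show "D \<inter> maker_claim h \<noteq> {}"
      proof
        assume miss: "D \<inter> maker_claim h = {}"
        have eq: "D - X = {}" using D \<open>\<H> \<subseteq> Pow X\<close> by auto
        have "1 = \<mu> ^ card (D - X)" unfolding eq by simp
        also have "\<dots> = (\<Sum>D\<in>{D}. \<mu> ^ card (D - X))" by simp
        also have "\<dots> \<le> potential \<H> \<mu> (maker_claim h) X"
          unfolding potential_def using D miss finH \<mu>0 by (intro sum_mono2) auto
        finally show False using less1 by simp
      qed
    qed
  next
    fix h assume h: "legal_play X 1 b h" "follows \<sigma> h"
      and notfull: "\<Union> (set h) \<noteq> X" and even: "even (length h)"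
    have "\<Union> (set h) \<subseteq> X" using inv[OF h] by (cases "h = []") auto
    then have free: "X - \<Union> (set h) \<noteq> {}" using notfull by auto
    then have "card (X - \<Union> (set h)) \<ge> 1" using \<open>finite X\<close> by (simp add: Suc_le_eq card_gt_0_iff)
    moreover have "\<sigma> h \<subseteq> X - \<Union> (set h)" "card (\<sigma> h) = 1"
      using best[OF free] \<open>e\<^sub>0 \<in> X\<close> by (auto simp: \<sigma>_def best_def)
    ultimately show "legal_move X 1 b h (\<sigma> h)"
      using even free by (simp add: legal_move_def Let_def)
  qed
  then show ?thesis unfolding maker_wins_def by blast
qed

section \<open>Cuts and colourings of a simple graph\<close>

lemma edge_connectivity_le_cut:
  assumes "finite E" "card V \<ge> 2" "S \<subseteq> V" "S \<noteq> {}" "S \<noteq> V"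
    and ends: "\<And>e. e \<in> E \<Longrightarrow> e = {p e, q e}"
  shows "edge_connectivity V E \<le> card (cut_edges p q E S)"
proof -
  let ?F = "cut_edges p q E S"
  let ?R = "{(x, y). {x, y} \<in> E - ?F}"
  obtain u v where uv: "u \<in> S" "v \<in> V" "v \<notin> S" using assms by auto
  have stays: "y \<in> S" if "(x, y) \<in> ?R" "x \<in> S" for x y
  proof -
    have "{x, y} \<in> E" "{x, y} \<notin> ?F" using that by auto
    moreover from this have "{x, y} = {p {x, y}, q {x, y}}" using ends by blast
    ultimately show ?thesis using that(2) by (auto simp: cut_edges_def doubleton_eq_iff)
  qed
  have "x \<in> S" if "(u, x) \<in> ?R\<^sup>*" for x
    using that by (induction rule: rtrancl_induct) (use uv stays in auto)
  then have "\<not> connected_graph V (E - ?F)"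
    using uv assms(3) unfolding connected_graph_def by blast
  then have "?F \<in> {F. F \<subseteq> E \<and> \<not> connected_graph V (E - F)}" by (auto simp: cut_edges_def)
  then have "Min (card ` {F. F \<subseteq> E \<and> \<not> connected_graph V (E - F)}) \<le> card ?F"
    using assms(1) by (intro Min_le) auto
  then show ?thesis using assms(2) by (simp add: edge_connectivity_def)
qed

lemma colorable_2_iff_cut:
  assumes "simple_graph V E" "M \<subseteq> E" and ends: "\<And>e. e \<in> E \<Longrightarrow> e = {p e, q e}"
  shows "colorable 2 V M \<longleftrightarrow> (\<exists>A\<subseteq>V. M \<subseteq> cut_edges p q E A)"
proof
  assume "colorable 2 V M"
  then obtain f :: "'a \<Rightarrow> nat"
    where f: "\<And>v. v \<in> V \<Longrightarrow> f v < 2" "\<And>u v. {u, v} \<in> M \<Longrightarrow> f u \<noteq> f v"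
    unfolding colorable_def by blast
  have "e \<in> cut_edges p q E {v \<in> V. f v = 0}" if e: "e \<in> M" for e
  proof -
    have eE: "e \<in> E" using e assms by auto
    then have eq: "e = {p e, q e}" by (rule ends)
    have "e \<subseteq> V" using eE assms(1) by (auto simp: simple_graph_def)
    then have V: "p e \<in> V" "q e \<in> V" using eq by blast+
    have "f (p e) \<noteq> f (q e)" using f(2) e eq by metis
    then have "(f (p e) = 0) \<noteq> (f (q e) = 0)" using f(1)[OF V(1)] f(1)[OF V(2)] by linarith
    then show ?thesis using V eE by (auto simp: cut_edges_def)
  qed
  then show "\<exists>A\<subseteq>V. M \<subseteq> cut_edges p q E A" by (intro exI[of _ "{v \<in> V. f v = 0}"]) auto
next
  assume "\<exists>A\<subseteq>V. M \<subseteq> cut_edges p q E A"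
  then obtain A where A: "M \<subseteq> cut_edges p q E A" by blast
  have "(if u \<in> A then 0 else 1::nat) \<noteq> (if v \<in> A then 0 else 1)" if "{u, v} \<in> M" for u v
  proof -
    have "{u, v} = {p {u, v}, q {u, v}}" using that assms(2) ends by blast
    moreover have "{u, v} \<in> cut_edges p q E A" using A that by blast
    ultimately show ?thesis by (auto simp: cut_edges_def doubleton_eq_iff)
  qed
  then show "colorable 2 V M"
    unfolding colorable_def by (intro exI[of _ "\<lambda>v. if v \<in> A then 0 else 1::nat"]) auto
qed

text \<open>An edge leaving \<open>A \<triangle> A\<^sub>0\<close> leaves exactly one of \<open>A\<close> and \<open>A\<^sub>0\<close>, hence is missing from one of
  the two cuts, and the maximum cut misses the fewest edges.\<close>

lemma cut_symdiff_le_defect: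
  assumes "finite E" and max: "card (E - cut_edges p q E A\<^sub>0) \<le> card (E - cut_edges p q E A)"
  shows "card (cut_edges p q E ((A - A\<^sub>0) \<union> (A\<^sub>0 - A))) \<le> 2 * card (E - cut_edges p q E A)"
proof -
  have "cut_edges p q E ((A - A\<^sub>0) \<union> (A\<^sub>0 - A)) \<subseteq> (E - cut_edges p q E A) \<union> (E - cut_edges p q E A\<^sub>0)"
    by (auto simp: cut_edges_def)
  then have "card (cut_edges p q E ((A - A\<^sub>0) \<union> (A\<^sub>0 - A)))
      \<le> card ((E - cut_edges p q E A) \<union> (E - cut_edges p q E A\<^sub>0))"
    using assms by (intro card_mono) auto
  also have "\<dots> \<le> card (E - cut_edges p q E A) + card (E - cut_edges p q E A\<^sub>0)" by (rule card_Un_le)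
  finally show ?thesis using max by linarith
qed

text \<open>The weight of a defect of size \<open>d\<close> in terms of the level \<open>a\<close> of the cut that
  bounds it from below: \<open>2b\<close> elements at least halve the weight, and \<open>6 a b L \<le> d\<close>.\<close>

lemma defect_weight_le:
  assumes "b > 0" "a * k \<le> 4 * d" "24 * b * L \<le> k" "n > 0" "2 * n \<le> 2 ^ L"
  shows "(1 / (1 + 1 / (2 * real b))) ^ d \<le> (1 / real (2 * n)) ^ (3 * a)"
proof -
  define \<mu> where "\<mu> = 1 / (1 + 1 / (2 * real b))"
  have \<mu>: "0 \<le> \<mu>" "\<mu> \<le> 1" using assms by (auto simp: \<mu>_def field_simps)
  have half: "\<mu> ^ (2 * b) \<le> 1/2"
  proof -
    have "2 = 1 + real (2 * b) * (1 / (2 * real b))" using assms by simp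
    also have "\<dots> \<le> (1 + 1 / (2 * real b)) ^ (2 * b)"
      by (rule Bernoulli_inequality) (use assms in \<open>simp add: field_simps\<close>)
    finally show ?thesis by (simp add: \<mu>_def power_one_over field_simps)
  qed
  have "a * (24 * b * L) \<le> a * k" using assms by (intro mult_le_mono2)
  also have "a * (24 * b * L) = 4 * (2 * b * (L * (3 * a)))" by simp
  finally have "2 * b * (L * (3 * a)) \<le> d" using assms(2) by linarith
  then have "\<mu> ^ d \<le> \<mu> ^ (2 * b * (L * (3 * a)))" using \<mu> by (intro power_decreasing)
  also have "\<dots> = (\<mu> ^ (2 * b)) ^ (L * (3 * a))" by (rule power_mult)
  also have "\<dots> \<le> (1/2) ^ (L * (3 * a))" using \<mu> half by (intro power_mono) auto
  also have "\<dots> = ((1/2) ^ L) ^ (3 * a)" by (rule power_mult)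
  also have "\<dots> \<le> (1 / real (2 * n)) ^ (3 * a)"
  proof (rule power_mono)
    have "real (2 * n) \<le> 2 ^ L" using assms(5) by (metis of_nat_le_iff of_nat_numeral of_nat_power)
    then show "(1/2) ^ L \<le> 1 / real (2 * n)"
      using assms(4) by (simp add: power_one_over frac_le)
  qed simp
  finally show ?thesis by (simp add: \<mu>_def)
qed

section \<open>The odd cycle game\<close>

text \<open>The map \<open>A \<mapsto> A \<triangle> A\<^sub>0\<close> sends the sets other than \<open>A\<^sub>0\<close> and \<open>V - A\<^sub>0\<close> injectively to the
  nontrivial cuts, so the initial potential of their defects is bounded by the sum over these
  cuts.\<close>

lemma odd_cycle_game_maker_wins:
  assumes G: "simple_graph V E" and n2: "card V \<ge> 2" and "b > 0"
    and L: "2 * card V \<le> 2 ^ L" "24 * b * L \<le> edge_connectivity V E"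
    and nonbip: "\<not> colorable 2 V E"
  shows "maker_wins E (NC_winning_sets 2 V E) 1 b"
proof -
  define k where "k = edge_connectivity V E"
  have finV: "finite V" using G by (simp add: simple_graph_def)
  have finE: "finite E" using G by (auto simp: simple_graph_def intro: finite_subset[of E "Pow V"])
  have "\<exists>u v. e = {u, v}" if "e \<in> E" for e
  proof -
    have "card e = 2" using G that by (simp add: simple_graph_def)
    then show ?thesis by (auto simp: card_2_iff)
  qed
  then obtain p q where ends: "\<And>e. e \<in> E \<Longrightarrow> e = {p e, q e}" by metis
  have pq: "p ` E \<subseteq> V" "q ` E \<subseteq> V"
  proof -
    have "p e \<in> V \<and> q e \<in> V" if "e \<in> E" for e
    proof -
      have "{p e, q e} \<subseteq> V" using ends[OF that] that G by (metis simple_graph_def)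
      then show ?thesis by simp
    qed
    then show "p ` E \<subseteq> V" "q ` E \<subseteq> V" by auto
  qed
  have "L > 0" using L(1) n2 by (cases L) auto
  then have "24 * b * L > 0" using \<open>b > 0\<close> by simp
  then have k0: "k > 0" using L(2) unfolding k_def by linarith
  have mincut: "k \<le> card (cut_edges p q E S)" if "S \<subseteq> V" "S \<noteq> {}" "S \<noteq> V" for S
    unfolding k_def using that n2 finE ends by (intro edge_connectivity_le_cut) auto
  define def where "def A = E - cut_edges p q E A" for A
  obtain A\<^sub>0 where A0: "A\<^sub>0 \<subseteq> V" "\<And>A. A \<subseteq> V \<Longrightarrow> card (def A\<^sub>0) \<le> card (def A)"
    using ex_has_least_nat[of "\<lambda>A. A \<subseteq> V" "{}" "\<lambda>A. card (def A)"] by auto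
  have "\<not> E \<subseteq> cut_edges p q E A\<^sub>0"
    using nonbip colorable_2_iff_cut[OF G subset_refl ends] A0(1) by blast
  then obtain e\<^sub>0 where e0: "e\<^sub>0 \<in> E" "e\<^sub>0 \<in> def A\<^sub>0" by (auto simp: def_def)
  define sd where "sd A = (A - A\<^sub>0) \<union> (A\<^sub>0 - A)" for A
  define \<A> where "\<A> = Pow V - {A\<^sub>0, V - A\<^sub>0}"
  define \<mu> where "\<mu> = 1 / (1 + 1 / (2 * real b))"
  define w where "w S = (1 / real (2 * card V)) ^ (3 * (2 * card (cut_edges p q E S) div k))" for S
  have weight: "\<mu> ^ card (def A) \<le> w (sd A)" if "A \<in> \<A>" for A
    unfolding \<mu>_def w_def
  proof (rule defect_weight_le)
    have "card (cut_edges p q E (sd A)) \<le> 2 * card (def A)"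
      using cut_symdiff_le_defect[OF finE, of p q A\<^sub>0 A] A0(2)[of A] that
      by (simp add: def_def sd_def \<A>_def)
    moreover have "2 * card (cut_edges p q E (sd A)) div k * k \<le> 2 * card (cut_edges p q E (sd A))"
      by simp
    ultimately show "2 * card (cut_edges p q E (sd A)) div k * k \<le> 4 * card (def A)" by linarith
  qed (use L n2 \<open>b > 0\<close> in \<open>auto simp: k_def\<close>)
  have inj: "inj_on sd \<A>" unfolding sd_def by (rule inj_onI) blast
  have img: "sd ` \<A> \<subseteq> Pow V - {{}, V}"
  proof (rule image_subsetI)
    fix A assume A: "A \<in> \<A>"
    have "sd A \<subseteq> V" using A A0(1) by (auto simp: \<A>_def sd_def)
    moreover have "sd A \<noteq> {}" using A by (auto simp: \<A>_def sd_def)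
    moreover have "A = V - A\<^sub>0" if "sd A = V"
    proof -
      have "A \<subseteq> V" using A by (auto simp: \<A>_def)
      then show ?thesis using that A0(1) unfolding sd_def by blast
    qed
    ultimately show "sd A \<in> Pow V - {{}, V}" using A by (auto simp: \<A>_def)
  qed
  have "(\<Sum>D\<in>def ` \<A>. \<mu> ^ card D) \<le> (\<Sum>A\<in>\<A>. \<mu> ^ card (def A))"
    by (rule order_trans[OF sum_image_le]) (use finV in \<open>auto simp: \<A>_def \<mu>_def\<close>)
  also have "\<dots> \<le> (\<Sum>A\<in>\<A>. w (sd A))" using weight by (rule sum_mono)
  also have "\<dots> = sum w (sd ` \<A>)" using inj by (simp add: sum.reindex)
  also have "\<dots> \<le> sum w (Pow V - {{}, V})"
    using img finV by (intro sum_mono2) (auto simp: w_def)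
  also have "\<dots> < 1/2"
    unfolding w_def by (rule cut_sum_less_half[OF finE finV n2 k0 pq mincut])
  finally have small: "(\<Sum>D\<in>def ` \<A>. \<mu> ^ card D) < 1/2" .
  show ?thesis
  proof (rule maker_wins_if_potential_small[OF finE e0(1) \<open>b > 0\<close> _ small[unfolded \<mu>_def]])
    show "def ` \<A> \<subseteq> Pow E" by (auto simp: def_def)
    fix M assume M: "M \<subseteq> E" "e\<^sub>0 \<in> M" and hit: "\<And>D. D \<in> def ` \<A> \<Longrightarrow> D \<inter> M \<noteq> {}"
    have "\<not> M \<subseteq> cut_edges p q E A" if A: "A \<subseteq> V" for A
    proof (cases "A \<in> \<A>")
      case True
      then show ?thesis using hit[of "def A"] by (auto simp: def_def)
    next
      \<comment> \<open>Complementary sets have the same cut, so \<open>e\<^sub>0\<close> serves both exceptional sets.\<close>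
      case False
      then have "A = A\<^sub>0 \<or> A = V - A\<^sub>0" using A by (auto simp: \<A>_def)
      moreover have "cut_edges p q E (V - A\<^sub>0) = cut_edges p q E A\<^sub>0"
        using pq by (auto simp: cut_edges_def)
      ultimately show ?thesis using e0 M by (auto simp: def_def)
    qed
    then have "\<not> colorable 2 V M" using colorable_2_iff_cut[OF G M(1) ends] by blast
    moreover have "simple_graph V M" using G M(1) by (auto simp: simple_graph_def)
    ultimately show "\<exists>W\<in>NC_winning_sets 2 V E. W \<subseteq> M"
      using M(1) unfolding NC_winning_sets_def by blast
  qed
qed

text \<open>For \<open>b \<ge> 2\<close> the factor \<open>b\<^sup>2 (log\<^sub>2 b)\<^sup>2\<close> is at least \<open>b\<close>, and \<open>2n \<le> 2\<^sup>L\<close> holds for some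
  \<open>L \<le> 3 log\<^sub>2 n\<close>; so the edge-connectivity exceeds \<open>24 b L\<close>.\<close>

theorem theorem1p4:
  fixes b :: nat
  assumes "b \<ge> 2"
  shows "\<exists>n\<^sub>0 :: nat. \<forall>(V :: 'v set) (E :: 'v set set).
           simple_graph V E \<longrightarrow>
           card V \<ge> n\<^sub>0 \<longrightarrow>
           edge_connected (10 ^ 4 * log 2 (real (card V)) * (real b)\<^sup>2 * (log 2 (real b))\<^sup>2) V E \<longrightarrow>
           chromatic_number V E \<ge> 3 \<longrightarrow>
           maker_wins E (NC_winning_sets 2 V E) 1 b"
proof (intro exI[of _ 2] allI impI)
  fix V :: "'v set" and E :: "'v set set"
  assume G: "simple_graph V E" and n2: "2 \<le> card V"
    and conn: "edge_connected (10 ^ 4 * log 2 (real (card V)) * (real b)\<^sup>2 * (log 2 (real b))\<^sup>2) V E"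
    and chi: "3 \<le> chromatic_number V E"
  define l where "l = log 2 (real (card V))"
  define L where "L = nat \<lceil>l + 1\<rceil>"
  have l1: "l \<ge> 1" using n2 by (simp add: l_def le_log_iff)
  have L_ge: "l + 1 \<le> real L" and L_le: "real L \<le> l + 2"
    using l1 unfolding L_def by linarith+
  have "real (2 * card V) = 2 powr (l + 1)" using n2 by (simp add: l_def powr_add)
  also have "\<dots> \<le> 2 powr real L" using L_ge by simp
  also have "\<dots> = real (2 ^ L)" by (simp add: powr_realpow)
  finally have pow: "2 * card V \<le> 2 ^ L" by (simp only: of_nat_le_iff)
  have b2: "real b \<ge> 2" using assms by simp
  have lb: "log 2 (real b) \<ge> 1" using b2 by (simp add: le_log_iff)
  have "real (24 * b * L) \<le> 24 * real b * (3 * l)"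
  proof -
    have "real b * real L \<le> real b * (3 * l)" using L_le l1 by (intro mult_left_mono) auto
    then show ?thesis by (simp add: mult_ac)
  qed
  also have "\<dots> \<le> 10 ^ 4 * l * real b" using l1 b2 by simp
  also have "\<dots> \<le> 10 ^ 4 * l * (real b)\<^sup>2"
    using l1 b2 by (intro mult_left_mono) (auto simp: power2_eq_square)
  also have "\<dots> \<le> 10 ^ 4 * l * (real b)\<^sup>2 * (log 2 (real b))\<^sup>2"
  proof -
    have "(log 2 (real b))\<^sup>2 \<ge> 1" using lb by simp
    then show ?thesis using mult_left_mono[of 1 "(log 2 (real b))\<^sup>2" "10 ^ 4 * l * (real b)\<^sup>2"] l1 by simp
  qed
  also have "\<dots> \<le> real (edge_connectivity V E)" using conn by (simp add: edge_connected_def l_def)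
  finally have "24 * b * L \<le> edge_connectivity V E" by (simp only: of_nat_le_iff)
  moreover have "\<not> colorable 2 V E"
  proof
    assume "colorable 2 V E"
    then have "chromatic_number V E \<le> 2" unfolding chromatic_number_def by (rule Least_le)
    then show False using chi by simp
  qed
  ultimately show "maker_wins E (NC_winning_sets 2 V E) 1 b"
    using G n2 assms pow by (intro odd_cycle_game_maker_wins) auto
qed

end
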